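(* Let $f:\mathbb{R}^n\to\mathbb{R}$ be continuously differentiable with Lipschitz continuous gradient $\nabla f$, $\varphi:\mathbb{R}^n\to\mathbb{R}$ convex, and $\psi:=f+\varphi$. Let $\{x^k\}$ be an (infinite) sequence generated by the regularized proximal quasi-Newton method described in the context, none of whose iterates is a stationary point of $\psi$, with symmetric matrices $B_k$ satisfying $mI\preceq B_k\preceq MI$ for all $k$ and some constants $M\ge m>0$. Assume that $\psi$ is bounded from below, that the set $\mathcal{X}^*$ of stationary points of $\psi$ is nonempty, and that: (a) for any $\zeta\ge\inf_x\psi(x)$ there exist scalars $\tau>0$ and $\varepsilon>0$ such that $\operatorname{dist}(x,\mathcal{X}^* )\le\tau\|r(x)\|$ whenever $\psi(x)\le\zeta$ and $\|r(x)\|\le\varepsilon$; (b) there exists a scalar $\delta>0$ such that $\|x-y\|\ge\delta$ whenever $x\in\mathcal{X}^*$, $y\in\mathcal{X}^*$ and $\psi(x)\ne\psi(y)$. Then the sequence $\{x^k\}$ converges to some $\overline{x}\in\mathbb{R}^n$ and $$\sum_{k=0}^\infty\|x^{k+1}-x^k\|<\infty .$$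
   Context: $\|\cdot\|$ is the Euclidean norm, $\operatorname{dist}$ the Euclidean distance to a set, and $A\preceq B$ means that $B-A$ is positive semidefinite. For a symmetric positive definite $H\in\mathbb{R}^{n\times n}$, $\operatorname{prox}_\varphi^H(x):=\arg\min_y\{\varphi(y)+\tfrac12(y-x)^TH(y-x)\}$, and $r_H(x):=\arg\min_d\{\nabla f(x)^Td+\tfrac12d^THd+\varphi(x+d)\}=\operatorname{prox}_\varphi^H(x-H^{-1}\nabla f(x))-x$; moreover $r(x):=r_I(x)$ with $I$ the identity matrix. A point $x^*$ is a stationary point of $\psi$ if $0\in\nabla f(x^* )+\partial\varphi(x^* )$, where $\partial\varphi$ is the convex subdifferential (equivalently $r(x^* )=0$). Regularized proximal quasi-Newton method. Choose $x^0\in\mathbb{R}^n$ and parameters $\mu_0>0$, $p_{\min}\in(0,\tfrac12)$, $c_1\in(0,\tfrac12)$, $c_2\in(c_1,1)$, $\sigma_1\in(0,1)$, $\sigma_2>1$. For $k=0,1,2,\dots$: choose $B_k\in\mathbb{R}^{n\times n}$, put $q_k(d):=f(x^k)+\nabla f(x^k)^Td+\tfrac12d^TB_kd+\varphi(x^k+d)$ and $\hat q_k(d):=q_k(d)+\tfrac12\mu_k\|d\|^2$, and let $d^k$ be a solution (global minimizer) of $\min_d\hat q_k(d)$, if one exists. Define $\operatorname{pred}_k:=\psi(x^k)-q_k(d^k)$ and $\operatorname{ared}_k:=\psi(x^k)-\psi(x^k+d^k)$. (i) If $\min_d\hat q_k(d)$ has no solution, or if $\operatorname{pred}_k\le p_{\min}\|d^k\|\,\|r(x^k)\|$,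 set $x^{k+1}:=x^k$ and $\mu_{k+1}:=\sigma_2\mu_k$. (ii) Otherwise set $\rho_k:=\operatorname{ared}_k/\operatorname{pred}_k$; set $x^{k+1}:=x^k$ if $\rho_k\le c_1$ and $x^{k+1}:=x^k+d^k$ otherwise; set $\mu_{k+1}:=\sigma_2\mu_k$ if $\rho_k\le c_1$, $\mu_{k+1}:=\mu_k$ if $c_1<\rho_k\le c_2$, and $\mu_{k+1}:=\sigma_1\mu_k$ if $\rho_k>c_2$. The method is run without stopping, producing an infinite sequence. *)

theory Defs
  imports "HOL-Analysis.Analysis"
begin

definition gradient :: "(real ^ 'n \<Rightarrow> real) \<Rightarrow> real ^ 'n \<Rightarrow> real ^ 'n" where
  "gradient f x = (THE D. GDERIV f x :> D)"

lemma gradient_eqI: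
  assumes "GDERIV f x :> D"
  shows "gradient f x = D"
  unfolding gradient_def
proof (rule the_equality)
  fix E assume "GDERIV f x :> E"
  from this assms have "(\<lambda>h. inner h E) = (\<lambda>h. inner h D)"
    unfolding gderiv_def by (rule has_derivative_unique)
  then have "inner (E - D) E = inner (E - D) D"
    by (rule fun_cong)
  then have "inner (E - D) (E - D) = 0"
    by (simp only: inner_diff_right diff_self)
  then show "E = D"
    by simp
qed (fact assms)

definition psd :: "real ^ 'n ^ 'n \<Rightarrow> bool" where
  "psd A \<longleftrightarrow> transpose A = A \<and> (\<forall>v. 0 \<le> v \<bullet> (A *v v))"

definition loewner_le :: "real ^ 'n ^ 'n \<Rightarrow> real ^ 'n ^ 'n \<Rightarrow> bool"  (infix "\<preceq>" 50) where
  "A \<preceq> B \<longleftrightarrow> psd (B - A)"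

definition subdifferential :: "(real ^ 'n \<Rightarrow> real) \<Rightarrow> real ^ 'n \<Rightarrow> (real ^ 'n) set" where
  "subdifferential \<phi> x = {g. \<forall>y. \<phi> x + g \<bullet> (y - x) \<le> \<phi> y}"

definition objective :: "(real ^ 'n \<Rightarrow> real) \<Rightarrow> (real ^ 'n \<Rightarrow> real) \<Rightarrow> real ^ 'n \<Rightarrow> real" where
  "objective f \<phi> x = f x + \<phi> x"

definition stationary_points ::
    "(real ^ 'n \<Rightarrow> real) \<Rightarrow> (real ^ 'n \<Rightarrow> real) \<Rightarrow> (real ^ 'n) set" where
  "stationary_points f \<phi> = {x. 0 \<in> (\<lambda>g. gradient f x + g) ` subdifferential \<phi> x}"

abbreviation is_global_min :: "('a \<Rightarrow> real) \<Rightarrow> 'a \<Rightarrow> bool" where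
  "is_global_min F \<equiv> is_arg_min F (\<lambda>_. True)"

text \<open>For convex \<open>\<phi>\<close> and positive definite \<open>H\<close> the minimization problem below is strongly convex,
  so the minimizer exists and is unique.\<close>

definition residual_wrt ::
    "real ^ 'n ^ 'n \<Rightarrow> (real ^ 'n \<Rightarrow> real) \<Rightarrow> (real ^ 'n \<Rightarrow> real) \<Rightarrow> real ^ 'n \<Rightarrow> real ^ 'n" where
  "residual_wrt H f \<phi> x =
     arg_min (\<lambda>d. gradient f x \<bullet> d + 1/2 * (d \<bullet> (H *v d)) + \<phi> (x + d)) (\<lambda>_. True)"

definition residual ::
    "(real ^ 'n \<Rightarrow> real) \<Rightarrow> (real ^ 'n \<Rightarrow> real) \<Rightarrow> real ^ 'n \<Rightarrow> real ^ 'n" where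
  "residual = residual_wrt (mat 1)"

definition qmodel ::
    "(real ^ 'n \<Rightarrow> real) \<Rightarrow> (real ^ 'n \<Rightarrow> real) \<Rightarrow> real ^ 'n ^ 'n \<Rightarrow> real ^ 'n \<Rightarrow> real ^ 'n \<Rightarrow> real" where
  "qmodel f \<phi> B x d = f x + gradient f x \<bullet> d + 1/2 * (d \<bullet> (B *v d)) + \<phi> (x + d)"

definition reg_qmodel ::
    "(real ^ 'n \<Rightarrow> real) \<Rightarrow> (real ^ 'n \<Rightarrow> real) \<Rightarrow> real ^ 'n ^ 'n \<Rightarrow> real \<Rightarrow>
     real ^ 'n \<Rightarrow> real ^ 'n \<Rightarrow> real" where
  "reg_qmodel f \<phi> B \<mu> x d = qmodel f \<phi> B x d + 1/2 * \<mu> * (norm d)\<^sup>2"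

definition pred_red ::
    "(real ^ 'n \<Rightarrow> real) \<Rightarrow> (real ^ 'n \<Rightarrow> real) \<Rightarrow> real ^ 'n ^ 'n \<Rightarrow> real ^ 'n \<Rightarrow> real ^ 'n \<Rightarrow> real" where
  "pred_red f \<phi> B x d = objective f \<phi> x - qmodel f \<phi> B x d"

definition ared_red ::
    "(real ^ 'n \<Rightarrow> real) \<Rightarrow> (real ^ 'n \<Rightarrow> real) \<Rightarrow> real ^ 'n \<Rightarrow> real ^ 'n \<Rightarrow> real" where
  "ared_red f \<phi> x d = objective f \<phi> x - objective f \<phi> (x + d)"

text \<open>One iteration, from \<open>(x, \<mu>)\<close> to \<open>(x', \<mu>')\<close>. If the subproblem has no
  minimizer, then \<open>d\<close> is unconstrained, and it does not influence the result.\<close>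

definition reg_prox_qn_step ::
    "(real ^ 'n \<Rightarrow> real) \<Rightarrow> (real ^ 'n \<Rightarrow> real) \<Rightarrow> real \<Rightarrow> real \<Rightarrow> real \<Rightarrow> real \<Rightarrow> real \<Rightarrow>
     real ^ 'n ^ 'n \<Rightarrow> real ^ 'n \<Rightarrow> real ^ 'n \<Rightarrow> real \<Rightarrow> real ^ 'n \<Rightarrow> real \<Rightarrow> bool" where
  "reg_prox_qn_step f \<phi> p_min c1 c2 \<sigma>1 \<sigma>2 B d x \<mu> x' \<mu>' \<longleftrightarrow>
     ((\<exists>e. is_global_min (reg_qmodel f \<phi> B \<mu> x) e) \<longrightarrow> is_global_min (reg_qmodel f \<phi> B \<mu> x) d) \<and>
     (if (\<nexists>e. is_global_min (reg_qmodel f \<phi> B \<mu> x) e) \<or>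
         pred_red f \<phi> B x d \<le> p_min * norm d * norm (residual f \<phi> x)
      then x' = x \<and> \<mu>' = \<sigma>2 * \<mu>
      else let \<rho> = ared_red f \<phi> x d / pred_red f \<phi> B x d
        in x' = (if \<rho> \<le> c1 then x else x + d) \<and>
           \<mu>' = (if \<rho> \<le> c1 then \<sigma>2 * \<mu> else if \<rho> \<le> c2 then \<mu> else \<sigma>1 * \<mu>))"

definition reg_prox_qn_sequence ::
    "(real ^ 'n \<Rightarrow> real) \<Rightarrow> (real ^ 'n \<Rightarrow> real) \<Rightarrow> real \<Rightarrow> real \<Rightarrow> real \<Rightarrow> real \<Rightarrow> real \<Rightarrow>
     (nat \<Rightarrow> real ^ 'n ^ 'n) \<Rightarrow> (nat \<Rightarrow> real ^ 'n) \<Rightarrow> (nat \<Rightarrow> real ^ 'n) \<Rightarrow> (nat \<Rightarrow> real) \<Rightarrow> bool" where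
  "reg_prox_qn_sequence f \<phi> p_min c1 c2 \<sigma>1 \<sigma>2 B d x \<mu> \<longleftrightarrow>
     (\<forall>k. reg_prox_qn_step f \<phi> p_min c1 c2 \<sigma>1 \<sigma>2 (B k) (d k) (x k) (\<mu> k) (x (Suc k)) (\<mu> (Suc k)))"

end

theory Submission
  imports Defs
begin

text \<open>
  Every accepted step \<open>d\<close> lowers the objective \<open>\<psi>\<close> by at least a multiple of \<open>\<parallel>d\<parallel>\<^sup>2\<close>, so the
  step lengths are square summable; this alone gives neither a finite path length nor convergence.
  What turns it into a geometric decrease is a matching upper bound: after the step, \<open>\<psi>\<close> exceeds its
  limit by at most a multiple of \<open>\<parallel>d\<parallel>\<^sup>2\<close>. If \<open>e k\<close> denotes that excess, the two bounds together say
  that \<open>\<parallel>d\<parallel>\<close> is at most a constant times \<open>sqrt (e k) - sqrt (e (Suc k))\<close>, which telescopes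
  (\<open>summable_of_quadratic_descent\<close>).

  The upper bound comes from the two assumptions on the stationary set. The residual at the current
  iterate is bounded by a multiple of \<open>\<parallel>d\<parallel>\<close>, hence tends to zero, and then the error bound supplies a
  stationary point \<open>z\<close> whose distance to the iterate is also at most a multiple of \<open>\<parallel>d\<parallel>\<close>. Optimality of
  \<open>d\<close> for the model, compared at \<open>z\<close>, gives \<open>\<psi> (x + d) - \<psi> z \<le> const * \<parallel>d\<parallel>\<^sup>2\<close>. Successive points
  \<open>z\<close> get arbitrarily close to each other, so by separation \<open>\<psi> z\<close> is eventually constant; and since
  \<open>\<psi>\<close> at a stationary point exceeds \<open>\<psi>\<close> at a nearby point only to second order, this constant is at
  most the limit of \<open>\<psi>\<close> along the iterates. The argument is
  \<open>summable_descent_under_error_bound\<close>, which knows the method only through three inequalities.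

  It remains to derive these inequalities from the method with constants independent of \<open>k\<close>. They
  follow from the subgradient inclusion that characterizes the minimizer of the regularized model
  (\<open>regularized_minimizer_estimates\<close>). The constants for the residual and for nearby stationary
  points deteriorate as the regularization parameter grows; but that parameter stays bounded,
  because both acceptance tests succeed once it reaches
  \<open>1 + M + 2 * L\<close> (\<open>reg_prox_qn_step_consequences\<close>).
\<close>

section \<open>Gradients and symmetric matrices\<close>

lemma GDERIV_gradient:
  fixes f :: "real ^ 'n \<Rightarrow> real"
  assumes "f differentiable (at x)"
  shows "GDERIV f x :> gradient f x"
proof -
  from assms obtain f' where f': "(f has_derivative f') (at x)"
    unfolding differentiable_def by blast
  have "f' h = inner h (adjoint f' 1)" for h
    using adjoint_works[OF has_derivative_linear[OF f'], of h 1] by simp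
  then have "f' = (\<lambda>h. inner h (adjoint f' 1))" by (rule ext)
  with f' have "GDERIV f x :> adjoint f' 1"
    unfolding gderiv_def by simp
  then show ?thesis using gradient_eqI by metis
qed

lemma inner_matrix_symmetric:
  fixes A :: "real ^ 'n ^ 'n"
  assumes "transpose A = A"
  shows "inner u (A *v v) = inner v (A *v u)"
  by (metis assms dot_lmul_matrix inner_commute transpose_matrix_vector)

lemma loewner_le_scaled_identityD:
  fixes A :: "real ^ 'n ^ 'n"
  shows "a *\<^sub>R mat 1 \<preceq> A \<Longrightarrow> a * (norm v)\<^sup>2 \<le> inner v (A *v v)"
    and "A \<preceq> b *\<^sub>R mat 1 \<Longrightarrow> inner v (A *v v) \<le> b * (norm v)\<^sup>2"
proof -
  have id: "(c *\<^sub>R mat 1 :: real ^ 'n ^ 'n) *v v = c *\<^sub>R v" for c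
    by (metis matrix_vector_mul_lid scaleR_matrix_vector_assoc)
  show "a *\<^sub>R mat 1 \<preceq> A \<Longrightarrow> a * (norm v)\<^sup>2 \<le> inner v (A *v v)"
    unfolding loewner_le_def psd_def
    by (auto simp: matrix_vector_mult_diff_rdistrib id inner_diff_right power2_norm_eq_inner
        dest!: spec[of _ v])
  show "A \<preceq> b *\<^sub>R mat 1 \<Longrightarrow> inner v (A *v v) \<le> b * (norm v)\<^sup>2"
    unfolding loewner_le_def psd_def
    by (auto simp: matrix_vector_mult_diff_rdistrib id inner_diff_right power2_norm_eq_inner
        dest!: spec[of _ v])
qed

text \<open>The Rayleigh quotient bounds the operator norm. Instead of diagonalizing \<open>A\<close>, one evaluates its
  nonnegative form at \<open>K v - A v\<close>: the mixed term produces \<open>\<parallel>A v\<parallel>\<^sup>2\<close>.\<close>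

lemma norm_matrix_vector_le_of_form_le:
  fixes A :: "real ^ 'n ^ 'n"
  assumes sym: "transpose A = A" and K: "0 < K"
    and nonneg: "\<And>v. 0 \<le> inner v (A *v v)"
    and le: "\<And>v. inner v (A *v v) \<le> K * (norm v)\<^sup>2"
  shows "norm (A *v v) \<le> K * norm v"
proof -
  define w where "w = A *v v"
  have "inner (K *\<^sub>R v - w) (A *v (K *\<^sub>R v - w))
      = K\<^sup>2 * inner v (A *v v) - 2 * K * inner w w + inner w (A *v w)"
    using inner_matrix_symmetric[OF sym, of v w]
    by (simp add: algebra_simps inner_diff_left inner_diff_right matrix_vector_mult_diff_distrib
        matrix_vector_mult_scaleR power2_eq_square w_def[symmetric])
  moreover have "0 \<le> inner (K *\<^sub>R v - w) (A *v (K *\<^sub>R v - w))" by (rule nonneg)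
  moreover have "K\<^sup>2 * inner v (A *v v) \<le> K\<^sup>2 * (K * (norm v)\<^sup>2)"
    using le by (intro mult_left_mono) auto
  moreover have "inner w (A *v w) \<le> K * (norm w)\<^sup>2" by (rule le)
  ultimately have "K * (norm w)\<^sup>2 \<le> K * (K * norm v)\<^sup>2"
    by (simp add: power_mult_distrib power2_norm_eq_inner[of w]) (simp add: power2_eq_square)
  with K have "(norm w)\<^sup>2 \<le> (K * norm v)\<^sup>2" by simp
  then show ?thesis
    using K unfolding w_def by (simp add: power2_le_iff_abs_le)
qed

section \<open>Minimizing a quadratic plus a convex function\<close>

text \<open>The regularization only shifts \<open>B\<close> by a multiple of the identity. Hence results on the model
  with an arbitrary matrix \<open>H\<close> cover both the regularized subproblem and, for the identity matrix,
  the residual.\<close>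

lemma shifted_matrix_vector:
  fixes B :: "real ^ 'n ^ 'n"
  shows "(B + \<mu> *\<^sub>R mat 1) *v v = B *v v + \<mu> *\<^sub>R v"
  by (metis matrix_vector_mul_lid scaleR_matrix_vector_assoc matrix_vector_mult_add_rdistrib)

lemma reg_qmodel_eq_shifted_model:
  "reg_qmodel f \<phi> B \<mu> x = (\<lambda>d. f x + inner (gradient f x) d
     + 1/2 * inner d ((B + \<mu> *\<^sub>R mat 1) *v d) + \<phi> (x + d))"
  unfolding shifted_matrix_vector
  by (rule ext) (simp add: reg_qmodel_def qmodel_def inner_add_right power2_norm_eq_inner
      algebra_simps)

lemma nonneg_of_affine_nonneg:
  fixes a b :: real
  assumes "\<And>t. 0 < t \<Longrightarrow> t \<le> 1 \<Longrightarrow> 0 \<le> a + t * b"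
  shows "0 \<le> a"
proof (rule tendsto_lowerbound)
  show "((\<lambda>t. a + t * b) \<longlongrightarrow> a) (at_right 0)"
    by (auto intro!: tendsto_eq_intros)
  show "\<forall>\<^sub>F t in at_right 0. 0 \<le> a + t * b"
    using assms by (auto simp: eventually_at_right_field intro!: exI[of _ 1])
qed auto

text \<open>First-order optimality. Along the segment from the minimizer to any \<open>y\<close>, convexity makes the
  nonsmooth part at most affine in \<open>t\<close>, while the curvature of the quadratic enters with
  \<open>t\<^sup>2\<close>; after division by \<open>t\<close>, letting \<open>t\<close> tend to zero leaves the subgradient inequality.\<close>

lemma minimizer_imp_subgradient:
  fixes \<phi> :: "real ^ 'n \<Rightarrow> real" and H :: "real ^ 'n ^ 'n"
  assumes conv: "convex_on UNIV \<phi>" and sym: "transpose H = H"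
    and min: "is_global_min (\<lambda>d. c + inner g d + 1/2 * inner d (H *v d) + \<phi> (x + d)) d"
  shows "- (g + H *v d) \<in> subdifferential \<phi> (x + d)"
  unfolding subdifferential_def
proof (clarify)
  fix y
  define w where "w = y - (x + d)"
  have "0 \<le> (inner g w + inner w (H *v d) + \<phi> y - \<phi> (x + d)) + t * (inner w (H *v w) / 2)"
    if t: "0 < t" "t \<le> 1" for t
  proof -
    have pt: "x + (d + t *\<^sub>R w) = (1 - t) *\<^sub>R (x + d) + t *\<^sub>R y"
      unfolding w_def by (simp add: algebra_simps)
    have conv_t: "\<phi> (x + (d + t *\<^sub>R w)) \<le> (1 - t) * \<phi> (x + d) + t * \<phi> y"
      unfolding pt using t by (intro convex_onD[OF conv]) auto
    have quad: "inner (d + t *\<^sub>R w) (H *v (d + t *\<^sub>R w))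
        = inner d (H *v d) + 2 * (t * inner w (H *v d)) + t * (t * inner w (H *v w))"
      using inner_matrix_symmetric[OF sym, of d w]
      by (simp add: algebra_simps inner_add_left inner_add_right matrix_vector_right_distrib
          matrix_vector_mult_scaleR)
    have "c + inner g d + 1/2 * inner d (H *v d) + \<phi> (x + d)
        \<le> c + inner g (d + t *\<^sub>R w) + 1/2 * inner (d + t *\<^sub>R w) (H *v (d + t *\<^sub>R w))
          + \<phi> (x + (d + t *\<^sub>R w))"
      using min unfolding is_arg_min_def by (meson not_less)
    then have "\<phi> (x + d) \<le> t * inner g w + t * inner w (H *v d) + t * (t * inner w (H *v w)) / 2
          + \<phi> (x + (d + t *\<^sub>R w))"
      unfolding quad inner_add_right[of g] inner_scaleR_right[of g] by (simp add: field_simps)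
    with conv_t have "0 \<le> t * ((inner g w + inner w (H *v d) + \<phi> y - \<phi> (x + d))
        + t * (inner w (H *v w) / 2))"
      by (simp add: algebra_simps)
    with t show ?thesis by (simp add: zero_le_mult_iff)
  qed
  then have "0 \<le> inner g w + inner w (H *v d) + \<phi> y - \<phi> (x + d)"
    by (rule nonneg_of_affine_nonneg)
  then show "\<phi> (x + d) + inner (- (g + H *v d)) (y - (x + d)) \<le> \<phi> y"
    unfolding w_def[symmetric] by (simp add: inner_diff_left inner_diff_right inner_commute)
qed

text \<open>A finite convex function cannot fall faster than linearly: the point at distance one from \<open>x\<close>
  on the ray to \<open>x + d\<close> is a convex combination of the two, and on the unit sphere around \<open>x\<close> the
  function is bounded by compactness. This gives coercivity of the model without producing an affine
  minorant by a separation theorem.\<close>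

lemma convex_linear_lower_bound:
  fixes \<phi> :: "real ^ 'n \<Rightarrow> real"
  assumes conv: "convex_on UNIV \<phi>"
  obtains A where "\<And>d. norm d \<ge> 1 \<Longrightarrow> \<phi> x - A * norm d \<le> \<phi> (x + d)"
proof -
  have cont: "continuous_on UNIV \<phi>"
    by (rule convex_on_continuous[OF open_UNIV conv])
  have "compact ((\<lambda>u. \<phi> (x + u)) ` sphere 0 1)"
    by (intro compact_continuous_image continuous_intros
        continuous_on_compose2[OF cont]) auto
  then obtain A where A: "\<And>u. norm u = 1 \<Longrightarrow> \<bar>\<phi> (x + u)\<bar> \<le> A"
    by (fastforce dest!: compact_imp_bounded simp: bounded_iff)
  have "\<phi> x - (\<bar>\<phi> x\<bar> + A) * norm d \<le> \<phi> (x + d)" if d: "norm d \<ge> 1" for d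
  proof -
    define t where "t = 1 / norm d"
    have t: "0 < t" "t \<le> 1" "t * norm d = 1" using d unfolding t_def by (auto simp: divide_simps)
    have pt: "x + t *\<^sub>R d = (1 - t) *\<^sub>R x + t *\<^sub>R (x + d)" by (simp add: algebra_simps)
    have "\<phi> (x + t *\<^sub>R d) \<le> (1 - t) * \<phi> x + t * \<phi> (x + d)"
      unfolding pt using t by (intro convex_onD[OF conv]) auto
    moreover have "- A \<le> \<phi> (x + t *\<^sub>R d)"
      using A[of "t *\<^sub>R d"] t by (auto simp: abs_le_iff)
    ultimately have "t * (\<phi> x - (\<bar>\<phi> x\<bar> + A) * norm d) \<le> t * \<phi> (x + d)"
      using t(3) by (simp add: algebra_simps)
        (smt (verit, del_insts) mult.commute mult.left_commute mult_cancel_left1)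
    with t show ?thesis by simp
  qed
  then show thesis by (rule that)
qed

lemma strongly_convex_model_has_minimizer:
  fixes \<phi> :: "real ^ 'n \<Rightarrow> real" and H :: "real ^ 'n ^ 'n"
  assumes conv: "convex_on UNIV \<phi>" and h: "0 < h"
    and H: "\<And>v. h * (norm v)\<^sup>2 \<le> inner v (H *v v)"
  shows "\<exists>d. is_global_min (\<lambda>d. c + inner g d + 1/2 * inner d (H *v d) + \<phi> (x + d)) d"
proof -
  define F where "F d = c + inner g d + 1/2 * inner d (H *v d) + \<phi> (x + d)" for d
  have "continuous_on UNIV F"
    unfolding F_def
    by (intro continuous_intros continuous_on_compose2[OF convex_on_continuous[OF open_UNIV conv]]
        matrix_vector_mult_linear_continuous_on) auto
  then have cont: "continuous_on S F" for S by (rule continuous_on_subset) auto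
  obtain A where A: "\<And>d. norm d \<ge> 1 \<Longrightarrow> \<phi> x - A * norm d \<le> \<phi> (x + d)"
    using convex_linear_lower_bound[OF conv] by blast
  \<comment> \<open>Beyond this radius the term \<open>h / 2 * (norm d)\<^sup>2\<close> outweighs the linear terms, whose slope is
    at worst \<open>- (norm g + A)\<close>.\<close>
  define R where "R = max 1 (2 * (norm g + A) / h)"
  have out: "F 0 \<le> F d" if d: "norm d > R" for d
  proof -
    have d1: "norm d \<ge> 1" and "2 * (norm g + A) / h \<le> norm d" using d unfolding R_def by auto
    then have d2: "norm g + A \<le> 1/2 * (h * norm d)" using h by (simp add: field_simps)
    have "- (norm g * norm d) \<le> inner g d"
      using Cauchy_Schwarz_ineq2[of g d] by (simp add: abs_le_iff)
    moreover have "(norm g + A) * norm d \<le> 1/2 * (h * norm d) * norm d"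
      using d2 by (rule mult_right_mono) simp
    ultimately show ?thesis
      using A[OF d1] H[of d] unfolding F_def by (simp add: algebra_simps power2_eq_square)
  qed
  have "0 \<le> R" unfolding R_def by simp
  then obtain d where d: "d \<in> cball 0 R" "\<And>y. y \<in> cball 0 R \<Longrightarrow> F d \<le> F y"
    using continuous_attains_inf[OF compact_cball _ cont, of 0 R] by auto
  have "F d \<le> F y" for y
  proof (cases "norm y \<le> R")
    case True then show ?thesis using d(2) by simp
  next
    case False then show ?thesis using out[of y] d(2)[of 0] \<open>0 \<le> R\<close> by simp
  qed
  then have "is_global_min F d" unfolding is_arg_min_def by (auto simp: not_less)
  then show ?thesis unfolding F_def by blast
qed

lemma residual_subgradient:
  fixes \<phi> :: "real ^ 'n \<Rightarrow> real"
  assumes conv: "convex_on UNIV \<phi>"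
  shows "- (gradient f x + residual f \<phi> x) \<in> subdifferential \<phi> (x + residual f \<phi> x)"
proof -
  \<comment> \<open>The residual is a choice of minimizer, so it satisfies optimality only because one exists.\<close>
  let ?F = "\<lambda>d. gradient f x \<bullet> d + 1/2 * (d \<bullet> ((mat 1 :: real ^ 'n ^ 'n) *v d)) + \<phi> (x + d)"
  have "\<exists>d. is_global_min (\<lambda>d. 0 + inner (gradient f x) d
      + 1/2 * inner d ((mat 1 :: real ^ 'n ^ 'n) *v d) + \<phi> (x + d)) d"
    by (rule strongly_convex_model_has_minimizer[OF conv, of 1])
      (auto simp: power2_norm_eq_inner)
  then have "is_global_min ?F (residual f \<phi> x)"
    unfolding residual_def residual_wrt_def arg_min_def by (simp add: someI_ex)
  then have "is_global_min (\<lambda>d. 0 + inner (gradient f x) d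
      + 1/2 * inner d ((mat 1 :: real ^ 'n ^ 'n) *v d) + \<phi> (x + d)) (residual f \<phi> x)"
    by simp
  from minimizer_imp_subgradient[OF conv _ this] show ?thesis
    by (simp add: transpose_mat)
qed

lemma residual_zero_imp_stationary:
  fixes \<phi> :: "real ^ 'n \<Rightarrow> real"
  assumes "convex_on UNIV \<phi>" and "residual f \<phi> x = 0"
  shows "x \<in> stationary_points f \<phi>"
  using residual_subgradient[OF assms(1), of f x] assms(2)
  unfolding stationary_points_def by (auto intro!: image_eqI[of _ _ "- gradient f x"])

text \<open>A short model step forces a small residual, because both vectors come with
  subgradients of \<open>\<phi>\<close>, at \<open>x + residual f \<phi> x\<close> and at \<open>x + d\<close>; adding the two
  subgradient inequalities (monotonicity of the subdifferential) cancels the values of \<open>\<phi>\<close> and the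
  gradient of \<open>f\<close>.\<close>

lemma residual_le_model_step:
  fixes \<phi> :: "real ^ 'n \<Rightarrow> real" and H :: "real ^ 'n ^ 'n"
  assumes conv: "convex_on UNIV \<phi>"
    and sub: "- (gradient f x + H *v d) \<in> subdifferential \<phi> (x + d)"
    and nonneg: "0 \<le> inner d (H *v d)"
    and H: "norm (H *v d) \<le> K * norm d"
  shows "norm (residual f \<phi> x) \<le> (1 + K) * norm d"
proof -
  define r where "r = residual f \<phi> x"
  have "\<phi> (x + r) + inner (- (gradient f x + r)) ((x + d) - (x + r)) \<le> \<phi> (x + d)"
    using residual_subgradient[OF conv, of f x] unfolding subdifferential_def r_def by blast
  moreover have "\<phi> (x + d) + inner (- (gradient f x + H *v d)) ((x + r) - (x + d)) \<le> \<phi> (x + r)"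
    using sub unfolding subdifferential_def by blast
  ultimately have "inner r r + inner d (H *v d) \<le> inner r d + inner r (H *v d)"
    by (simp add: algebra_simps inner_diff_right inner_add_left inner_add_right inner_commute
        inner_diff_left)
  also have "\<dots> \<le> norm r * norm d + norm r * (K * norm d)"
    by (meson H add_mono mult_left_mono norm_cauchy_schwarz norm_ge_zero order_trans)
  finally have "norm r * norm r \<le> norm r * ((1 + K) * norm d)"
    using nonneg by (simp add: dot_square_norm power2_eq_square algebra_simps)
  moreover have "0 \<le> (1 + K) * norm d"
    using order_trans[OF norm_ge_zero H] by (simp add: distrib_right add_nonneg_nonneg)
  ultimately show ?thesis
    unfolding r_def[symmetric] by (cases "r = 0") (auto simp only: mult_le_cancel_left norm_zero zero_less_norm_iff not_less)
qed

section \<open>Summability from quadratic descent\<close>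

text \<open>With \<open>b = sqrt (e (Suc k))\<close>, the gap condition says \<open>b \<le> sqrt C * s k\<close>, so
  \<open>(b + \<kappa> * s k)\<^sup>2\<close> exceeds \<open>b\<^sup>2\<close> by at most \<open>(2 * \<kappa> * sqrt C + \<kappa>\<^sup>2) * (s k)\<^sup>2\<close>. For small
  \<open>\<kappa>\<close> this is at most the guaranteed decrease \<open>c * (s k)\<^sup>2\<close>; hence \<open>b + \<kappa> * s k \<le> sqrt (e k)\<close>,
  and \<open>\<kappa> * s k\<close> is dominated by a telescoping series. Indices with \<open>s k = 0\<close> carry no
  information but do not disturb the telescoping, which allows rejected steps.\<close>

lemma summable_of_quadratic_descent:
  fixes e s :: "nat \<Rightarrow> real"
  assumes c: "0 < c" and C: "0 \<le> C"
    and e: "decseq e" "\<And>k. 0 \<le> e k" and s: "\<And>k. 0 \<le> s k"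
    and descent: "\<And>k. s k \<noteq> 0 \<Longrightarrow> c * (s k)\<^sup>2 \<le> e k - e (Suc k)"
    and gap: "\<And>k. k \<ge> N \<Longrightarrow> s k \<noteq> 0 \<Longrightarrow> e (Suc k) \<le> C * (s k)\<^sup>2"
  shows "summable s"
proof -
  define \<kappa> where "\<kappa> = min 1 (c / (1 + 2 * sqrt C))"
  have den: "0 < 1 + 2 * sqrt C" using C by (simp add: add_pos_nonneg)
  have \<kappa>: "0 < \<kappa>" "\<kappa> \<le> 1" "\<kappa> * (1 + 2 * sqrt C) \<le> c"
    using c den mult_right_mono[OF min.cobounded2[of 1 "c / (1 + 2 * sqrt C)"], of "1 + 2 * sqrt C"]
    unfolding \<kappa>_def by auto
  have key: "\<kappa> * s k \<le> sqrt (e k) - sqrt (e (Suc k))" if k: "k \<ge> N" for k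
  proof (cases "s k = 0")
    case True
    then show ?thesis using e(1) by (simp add: decseq_Suc_iff)
  next
    case False
    define b where "b = sqrt (e (Suc k))"
    have b: "b \<le> sqrt C * s k" "0 \<le> b" "b\<^sup>2 = e (Suc k)"
      using gap[OF k False] s[of k] e(2) unfolding b_def
      by (auto simp: real_sqrt_mult dest: real_sqrt_le_mono)
    have "(b + \<kappa> * s k)\<^sup>2 = b\<^sup>2 + 2 * \<kappa> * s k * b + (\<kappa> * \<kappa>) * (s k)\<^sup>2"
      by (simp add: power2_eq_square algebra_simps)
    also have "\<dots> \<le> b\<^sup>2 + 2 * \<kappa> * s k * (sqrt C * s k) + (\<kappa> * 1) * (s k)\<^sup>2"
      using \<kappa> s[of k] b(1)
      by (intro add_mono mult_left_mono mult_right_mono) auto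
    also have "\<dots> = b\<^sup>2 + \<kappa> * (1 + 2 * sqrt C) * (s k)\<^sup>2"
      by (simp add: power2_eq_square algebra_simps)
    also have "\<dots> \<le> b\<^sup>2 + c * (s k)\<^sup>2"
      using \<kappa>(3) by (intro add_left_mono mult_right_mono) auto
    also have "\<dots> \<le> e k" using descent[OF False] b(3) by simp
    finally have "b + \<kappa> * s k \<le> sqrt (e k)" by (rule real_le_rsqrt)
    then show ?thesis unfolding b_def by simp
  qed
  obtain l where "e \<longlonglongrightarrow> l" using decseq_convergent[OF e(1), of 0] e(2) by blast
  then have "summable (\<lambda>k. sqrt (e k) - sqrt (e (Suc k)))"
    by (intro telescope_summable'[of _ "sqrt l"] tendsto_real_sqrt)
  then have "summable (\<lambda>k. \<kappa> * s k)"
    by (rule summable_comparison_test[rotated]) (use key \<kappa> s in \<open>auto intro!: exI[of _ N]\<close>)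
  then show ?thesis using \<kappa>(1) by (simp add: summable_cmult_iff)
qed

section \<open>Descent sequences under an error bound\<close>

locale composite_problem =
  fixes f \<phi> :: "real ^ 'n \<Rightarrow> real" and L :: real
  assumes differentiable: "f differentiable (at y)"
    and lipschitz: "L-lipschitz_on UNIV (gradient f)"
    and convex: "convex_on UNIV \<phi>"
begin

abbreviation "g \<equiv> gradient f"
abbreviation "\<psi> \<equiv> objective f \<phi>"
abbreviation "r \<equiv> residual f \<phi>"
abbreviation "X \<equiv> stationary_points f \<phi>"

lemma L_nonneg: "0 \<le> L"
  using lipschitz by (rule lipschitz_on_nonneg)

text \<open>The sharp constant is \<open>L / 2\<close>. The weaker one follows from the mean value inequality, without
  integrating the gradient, and all estimates below tolerate it.\<close>

lemma linearization_error: "\<bar>f y - f x - inner (g x) (y - x)\<bar> \<le> L * (norm (y - x))\<^sup>2"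
proof -
  have "norm (f y - f x - inner (y - x) (g x)) \<le> norm (y - x) * (L * norm (y - x))"
  proof (rule differentiable_bound_linearization[where S = "closed_segment x y"
        and f' = "\<lambda>z h. inner h (g z)"])
    show "x + t *\<^sub>R (y - x) \<in> closed_segment x y" if "t \<in> {0..1}" for t
      using that unfolding closed_segment_def by (auto simp: algebra_simps intro!: exI[of _ t])
    show "(f has_derivative (\<lambda>h. inner h (g z))) (at z within closed_segment x y)" for z
      using GDERIV_gradient[OF differentiable[of z]] unfolding gderiv_def
      by (rule has_derivative_at_withinI)
    show "onorm ((\<lambda>h. inner h (g z)) - (\<lambda>h. inner h (g x))) \<le> L * norm (y - x)"
      if z: "z \<in> closed_segment x y" for z
    proof (rule onorm_bound)
      have "norm (g z - g x) \<le> L * norm (z - x)"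
        using lipschitz_onD[OF lipschitz, of z x] by (simp add: dist_norm)
      also have "\<dots> \<le> L * norm (y - x)"
        using segment_bound1[OF z] L_nonneg by (intro mult_left_mono)
      finally have le: "norm (g z - g x) \<le> L * norm (y - x)" .
      show "norm (((\<lambda>h. inner h (g z)) - (\<lambda>h. inner h (g x))) h) \<le> L * norm (y - x) * norm h" for h
      proof -
        have "norm (inner h (g z - g x)) \<le> norm h * norm (g z - g x)"
          by (simp add: Cauchy_Schwarz_ineq2)
        also have "\<dots> \<le> norm h * (L * norm (y - x))" using le by (rule mult_left_mono) simp
        finally show ?thesis by (simp add: inner_diff_right mult_ac)
      qed
    qed (use L_nonneg in simp)
  qed simp
  then show ?thesis by (simp add: power2_eq_square mult_ac inner_commute)
qed

lemma residual_nonzero: "x \<notin> X \<Longrightarrow> r x \<noteq> 0"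
  using residual_zero_imp_stationary[OF convex] by blast

text \<open>At a stationary point, \<open>- g z\<close> is a subgradient of \<open>\<phi>\<close>, which cancels the linear part of \<open>f\<close>.
  A stationary value can therefore exceed nearby values only to second order, even though \<open>f\<close> may be
  nonconvex.\<close>

lemma objective_ge_stationary:
  assumes "z \<in> X"
  shows "\<psi> z - L * (norm (x - z))\<^sup>2 \<le> \<psi> x"
proof -
  have "- g z \<in> subdifferential \<phi> z"
    using assms unfolding stationary_points_def by (auto simp: eq_neg_iff_add_eq_0 add.commute minus_unique)
  then have "\<phi> z + inner (- g z) (x - z) \<le> \<phi> x" unfolding subdifferential_def by blast
  then show ?thesis using linearization_error[of x z] unfolding objective_def by (simp add: abs_le_iff)
qed

text \<open>The hypotheses \<open>descent\<close>, \<open>res\<close> and \<open>near\<close> concern only the indices at which the sequence moves.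
  If it moves infinitely often, each resting point is left by a later move, so the residual and the
  nearby stationary points can be controlled at all indices. This makes consecutive stationary
  points comparable without passing to the subsequence of moves.\<close>

lemma summable_descent_under_error_bound:
  fixes x :: "nat \<Rightarrow> real ^ 'n"
  defines "s \<equiv> \<lambda>k. norm (x (Suc k) - x k)"
  assumes c: "0 < c" and K: "0 < K"
    and descent: "\<And>k. s k \<noteq> 0 \<Longrightarrow> c * (s k)\<^sup>2 \<le> \<psi> (x k) - \<psi> (x (Suc k))"
    and res: "\<And>k. s k \<noteq> 0 \<Longrightarrow> norm (r (x k)) \<le> K * s k"
    and near: "\<And>k z. s k \<noteq> 0 \<Longrightarrow> z \<in> X \<Longrightarrow>
      \<psi> (x (Suc k)) - \<psi> z \<le> K * ((s k)\<^sup>2 + (norm (x k - z))\<^sup>2)"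
    and notX: "\<And>k. x k \<notin> X" and nonempty: "X \<noteq> {}"
    and bdd: "bdd_below (range \<psi>)"
    and \<tau>: "0 < \<tau>" and \<epsilon>: "0 < \<epsilon>"
    and error_bound: "\<And>y. \<psi> y \<le> \<psi> (x 0) \<Longrightarrow> norm (r y) \<le> \<epsilon> \<Longrightarrow> infdist y X \<le> \<tau> * norm (r y)"
    and \<delta>: "0 < \<delta>"
    and separation: "\<And>y z. y \<in> X \<Longrightarrow> z \<in> X \<Longrightarrow> \<psi> y \<noteq> \<psi> z \<Longrightarrow> \<delta> \<le> norm (y - z)"
  shows "summable s"
proof (cases "\<exists>N. \<forall>k\<ge>N. s k = 0")
  case True
  then obtain N where "\<And>k. k \<ge> N \<Longrightarrow> s k = 0" by blast
  then show ?thesis by (intro summable_finite[of "{..<N}"]) auto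
next
  case False
  have s0: "0 \<le> s k" for k unfolding s_def by simp
  have dec: "decseq (\<lambda>k. \<psi> (x k))"
  proof (rule decseq_SucI)
    fix k
    show "\<psi> (x (Suc k)) \<le> \<psi> (x k)"
    proof (cases "s k = 0")
      case True then show ?thesis unfolding s_def by simp
    next
      case False
      have "0 \<le> c * (s k)\<^sup>2" using c by simp
      then show ?thesis using descent[OF False] by linarith
    qed
  qed
  from bdd obtain b where "\<forall>k. b \<le> \<psi> (x k)" unfolding bdd_below_def by auto
  then obtain l where l: "(\<lambda>k. \<psi> (x k)) \<longlonglongrightarrow> l" "\<And>k. l \<le> \<psi> (x k)"
    using decseq_convergent[OF dec] by metis
  have s_lim: "s \<longlonglongrightarrow> 0"
  proof -
    have "(\<lambda>k. (\<psi> (x k) - \<psi> (x (Suc k))) / c) \<longlonglongrightarrow> (l - l) / c"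
      using c by (intro tendsto_intros l LIMSEQ_Suc[OF l(1)]) simp
    then have lim: "(\<lambda>k. sqrt ((\<psi> (x k) - \<psi> (x (Suc k))) / c)) \<longlonglongrightarrow> 0"
      using tendsto_real_sqrt by fastforce
    have "s k \<le> sqrt ((\<psi> (x k) - \<psi> (x (Suc k))) / c)" for k
    proof (cases "s k = 0")
      case True then show ?thesis using c decseqD[OF dec, of k "Suc k"] by simp
    next
      case False then show ?thesis using c descent[OF False]
        by (intro real_le_rsqrt) (simp add: field_simps)
    qed
    then show ?thesis using s0 by (intro tendsto_sandwich[OF _ _ tendsto_const lim]) auto
  qed
  have res_bound: "\<exists>j\<ge>k. norm (r (x k)) \<le> K * s j" for k
  proof -
    define j where "j = (LEAST j. j \<ge> k \<and> s j \<noteq> 0)"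
    have "\<exists>j. j \<ge> k \<and> s j \<noteq> 0" using False by blast
    from LeastI_ex[OF this] have j: "j \<ge> k" "s j \<noteq> 0" unfolding j_def by auto
    have "i \<le> j \<Longrightarrow> x i = x k" if "k \<le> i" for i
      using that
    proof (induction i rule: dec_induct)
      case (step i)
      then have "\<not> (i \<ge> k \<and> s i \<noteq> 0)" unfolding j_def by (intro not_less_Least) simp
      then have "x (Suc i) = x i" using step.hyps unfolding s_def by simp
      then show ?case using step by simp
    qed simp
    then have "x j = x k" using j(1) by blast
    then show ?thesis using j res[OF j(2)] by auto
  qed
  have r_lim: "(\<lambda>k. norm (r (x k))) \<longlonglongrightarrow> 0"
  proof (rule LIMSEQ_I)
    fix \<eta> :: real assume "0 < \<eta>"
    then obtain N where N: "\<And>j. j \<ge> N \<Longrightarrow> s j < \<eta> / K"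
      using LIMSEQ_D[OF s_lim, of "\<eta> / K"] K s0 by auto
    have "norm (r (x k)) < \<eta>" if "k \<ge> N" for k
    proof -
      obtain j where "j \<ge> k" "norm (r (x k)) \<le> K * s j" using res_bound by blast
      then show ?thesis using N[of j] that K by (simp add: field_simps)
    qed
    then show "\<exists>N. \<forall>k\<ge>N. norm (norm (r (x k)) - 0) < \<eta>" by auto
  qed
  then obtain N where N: "\<And>k. k \<ge> N \<Longrightarrow> norm (r (x k)) \<le> \<epsilon>"
    using LIMSEQ_D[OF r_lim \<epsilon>] by (metis abs_norm_cancel diff_zero less_imp_le real_norm_def)
  \<comment> \<open>The factor 2 makes the inequality strict, since the residual does not vanish, so some
    stationary point is closer than this bound, whether or not the infimum is attained.\<close>
  have "\<exists>z\<in>X. norm (x k - z) \<le> 2 * \<tau> * norm (r (x k))" if "k \<ge> N" for k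
  proof -
    have "infdist (x k) X \<le> \<tau> * norm (r (x k))"
      using decseqD[OF dec, of 0 k] by (intro error_bound N that) simp
    also have "\<dots> < 2 * \<tau> * norm (r (x k))" using \<tau> residual_nonzero[OF notX] by simp
    finally have "(INF z\<in>X. dist (x k) z) < 2 * \<tau> * norm (r (x k))"
      using nonempty by (simp add: infdist_def)
    then show ?thesis using nonempty cInf_lessD[of "dist (x k) ` X"] by (force simp: dist_norm intro: less_imp_le)
  qed
  then obtain z where z: "\<And>k. k \<ge> N \<Longrightarrow> z k \<in> X"
      "\<And>k. k \<ge> N \<Longrightarrow> norm (x k - z k) \<le> 2 * \<tau> * norm (r (x k))"
    by metis
  have z_lim: "(\<lambda>k. norm (x k - z k)) \<longlonglongrightarrow> 0"
  proof (rule tendsto_sandwich[OF _ _ tendsto_const])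
    show "(\<lambda>k. 2 * \<tau> * norm (r (x k))) \<longlonglongrightarrow> 0"
      using tendsto_mult_left[OF r_lim, of "2 * \<tau>"] by simp
    show "\<forall>\<^sub>F k in sequentially. norm (x k - z k) \<le> 2 * \<tau> * norm (r (x k))"
      using z(2) by (auto simp: eventually_sequentially)
  qed simp
  have "(\<lambda>k. norm (x k - z k) + s k + norm (x (Suc k) - z (Suc k))) \<longlonglongrightarrow> 0 + 0 + 0"
    by (intro tendsto_add z_lim s_lim LIMSEQ_Suc[OF z_lim])
  then have "\<forall>\<^sub>F k in sequentially. norm (x k - z k) + s k + norm (x (Suc k) - z (Suc k)) < \<delta>"
    using \<delta> by (intro order_tendstoD(2)[of _ "0 :: real"]) auto
  then obtain N' where N': "N' \<ge> N"
      "\<And>k. k \<ge> N' \<Longrightarrow> norm (x k - z k) + s k + norm (x (Suc k) - z (Suc k)) < \<delta>"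
    unfolding eventually_sequentially by (metis nat_le_linear order_trans)
  define V where "V = \<psi> (z N')"
  \<comment> \<open>Consecutive points \<open>z k\<close> are now closer than the separation distance.\<close>
  have V: "\<psi> (z k) = V" if "k \<ge> N'" for k
    using that
  proof (induction k rule: dec_induct)
    case base then show ?case unfolding V_def ..
  next
    case (step k)
    have "z k - z (Suc k) = - (x k - z k) - (x (Suc k) - x k) + (x (Suc k) - z (Suc k))" by simp
    then have "norm (z k - z (Suc k)) \<le> norm (x k - z k) + s k + norm (x (Suc k) - z (Suc k))"
      using norm_triangle_ineq[of "- (x k - z k) - (x (Suc k) - x k)" "x (Suc k) - z (Suc k)"]
        norm_triangle_ineq4[of "- (x k - z k)" "x (Suc k) - x k"]
      unfolding s_def by (simp only: norm_minus_cancel)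
    then have "norm (z k - z (Suc k)) < \<delta>" using N'(2)[of k] step.hyps by linarith
    then have "\<psi> (z k) = \<psi> (z (Suc k))"
      using separation[of "z k" "z (Suc k)"] z(1)[of k] z(1)[of "Suc k"] N'(1) step.hyps by force
    then show ?case using step.IH by simp
  qed
  have "V \<le> l"
  proof (rule LIMSEQ_le_const)
    have "(\<lambda>k. \<psi> (x k) + L * (norm (x k - z k))\<^sup>2) \<longlonglongrightarrow> l + L * 0\<^sup>2"
      by (intro tendsto_intros l z_lim)
    then show "(\<lambda>k. \<psi> (x k) + L * (norm (x k - z k))\<^sup>2) \<longlonglongrightarrow> l" by simp
    show "\<exists>n. \<forall>k\<ge>n. V \<le> \<psi> (x k) + L * (norm (x k - z k))\<^sup>2"
    proof (intro exI allI impI)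
      fix k assume k: "k \<ge> N'"
      then show "V \<le> \<psi> (x k) + L * (norm (x k - z k))\<^sup>2"
        using objective_ge_stationary[of "z k" "x k"] V[OF k] z(1)[of k] N'(1) by simp
    qed
  qed
  show ?thesis
  proof (rule summable_of_quadratic_descent[where e = "\<lambda>k. \<psi> (x k) - l" and c = c
        and C = "K * (1 + (2 * \<tau> * K)\<^sup>2)" and N = N'])
    show "decseq (\<lambda>k. \<psi> (x k) - l)" using dec by (simp add: decseq_def)
    show "\<psi> (x (Suc k)) - l \<le> K * (1 + (2 * \<tau> * K)\<^sup>2) * (s k)\<^sup>2" if k: "k \<ge> N'" and sk: "s k \<noteq> 0" for k
    proof -
      have kN: "k \<ge> N" using k N'(1) by simp
      have "norm (x k - z k) \<le> 2 * \<tau> * (K * s k)"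
        using z(2)[OF kN] mult_left_mono[OF res[OF sk], of "2 * \<tau>"] \<tau> by linarith
      then have "(norm (x k - z k))\<^sup>2 \<le> (2 * \<tau> * (K * s k))\<^sup>2" by (intro power_mono) auto
      then have "K * ((s k)\<^sup>2 + (norm (x k - z k))\<^sup>2) \<le> K * ((s k)\<^sup>2 + (2 * \<tau> * (K * s k))\<^sup>2)"
        using K by simp
      then show ?thesis
        using near[OF sk z(1)[OF kN]] V[OF k] \<open>V \<le> l\<close>
        by (simp add: power_mult_distrib algebra_simps)
    qed
  qed (use c K l descent s0 in auto)
qed

section \<open>One iteration of the method\<close>

text \<open>All estimates are instances of the subgradient inequality at \<open>x + d\<close>, for the subgradient
  \<open>- (g x + H d)\<close> with \<open>H = B + \<mu> I\<close>: tested at \<open>x\<close> it bounds the predicted reduction, and tested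
  at a stationary point \<open>z\<close> it bounds \<open>\<psi> (x + d) - \<psi> z\<close>. In the latter the gradient terms combine
  with the linearization errors of \<open>f\<close> at \<open>x + d\<close> and \<open>z\<close>, so only second-order terms are left.\<close>

lemma regularized_minimizer_estimates:
  assumes sym: "transpose B = B" and m: "0 < m" "m \<le> M" and \<mu>: "0 < \<mu>"
    and B: "m *\<^sub>R mat 1 \<preceq> B" "B \<preceq> M *\<^sub>R mat 1"
    and min: "is_global_min (reg_qmodel f \<phi> B \<mu> x) d"
  shows step_residual: "norm (r x) \<le> (1 + M + \<mu>) * norm d"
    and step_pred: "(m / 2 + \<mu>) * (norm d)\<^sup>2 \<le> pred_red f \<phi> B x d"
    and step_ared: "pred_red f \<phi> B x d - L * (norm d)\<^sup>2 \<le> ared_red f \<phi> x d"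
    and step_near: "z \<in> X \<Longrightarrow>
      \<psi> (x + d) - \<psi> z \<le> (M + \<mu> + L) * ((norm d)\<^sup>2 + (norm (x - z))\<^sup>2)"
proof -
  define H where "H = B + \<mu> *\<^sub>R mat 1"
  have Hv: "H *v v = B *v v + \<mu> *\<^sub>R v" for v
    unfolding H_def by (rule shifted_matrix_vector)
  have symH: "transpose H = H"
    using sym unfolding H_def by (simp add: transpose_def vec_eq_iff mat_def) 
  note B_lower = loewner_le_scaled_identityD(1)[OF B(1)]
    and B_upper = loewner_le_scaled_identityD(2)[OF B(2)]
  have B_nonneg: "0 \<le> inner v (B *v v)" for v
    using B_lower[of v] m by (smt (verit) mult_nonneg_nonneg zero_le_power2)
  have "norm (B *v d) \<le> M * norm d"
    using m by (intro norm_matrix_vector_le_of_form_le[OF sym _ B_nonneg B_upper]) simp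
  then have norm_H: "norm (H *v d) \<le> (M + \<mu>) * norm d"
    unfolding Hv using norm_triangle_ineq[of "B *v d" "\<mu> *\<^sub>R d"] \<mu> by (simp add: distrib_right)
  have dHd: "inner d (H *v d) = inner d (B *v d) + \<mu> * (norm d)\<^sup>2"
    unfolding Hv by (simp add: inner_add_right power2_norm_eq_inner)
  have "reg_qmodel f \<phi> B \<mu> x = (\<lambda>d. f x + inner (g x) d + 1/2 * inner d (H *v d) + \<phi> (x + d))"
    unfolding H_def by (rule reg_qmodel_eq_shifted_model)
  with min have "is_global_min
      (\<lambda>d. f x + inner (g x) d + 1/2 * inner d (H *v d) + \<phi> (x + d)) d" by (simp only:)
  then have sub: "- (g x + H *v d) \<in> subdifferential \<phi> (x + d)"
    by (rule minimizer_imp_subgradient[OF convex symH])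
  have dHd0: "0 \<le> inner d (H *v d)" unfolding dHd using B_nonneg[of d] \<mu> by simp
  show "norm (r x) \<le> (1 + M + \<mu>) * norm d"
    using residual_le_model_step[OF convex sub dHd0 norm_H] by (simp add: add.assoc)
  have "\<phi> (x + d) + inner (- (g x + H *v d)) (x - (x + d)) \<le> \<phi> x"
    using sub unfolding subdifferential_def by blast
  then have "\<phi> (x + d) + inner (g x) d + inner d (H *v d) \<le> \<phi> x"
    by (simp add: inner_diff_right inner_commute)
  then show "(m / 2 + \<mu>) * (norm d)\<^sup>2 \<le> pred_red f \<phi> B x d"
    using B_lower[of d] unfolding dHd pred_red_def qmodel_def objective_def
    by (simp add: algebra_simps)
  show "pred_red f \<phi> B x d - L * (norm d)\<^sup>2 \<le> ared_red f \<phi> x d"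
    using linearization_error[of "x + d" x] B_nonneg[of d]
    unfolding pred_red_def ared_red_def qmodel_def objective_def by (simp add: abs_le_iff)
  show "\<psi> (x + d) - \<psi> z \<le> (M + \<mu> + L) * ((norm d)\<^sup>2 + (norm (x - z))\<^sup>2)"
  proof -
    have "\<phi> (x + d) + inner (- (g x + H *v d)) (z - (x + d)) \<le> \<phi> z"
      using sub unfolding subdifferential_def by blast
    then have "\<phi> (x + d) - \<phi> z \<le> inner (g x) (z - x) - inner (g x) d
        - inner d (H *v d) + inner (H *v d) (z - x)"
      by (simp add: algebra_simps inner_diff_right inner_add_left inner_add_right inner_commute)
    moreover have "inner (H *v d) (z - x) \<le> (M + \<mu>) * ((norm d)\<^sup>2 + (norm (x - z))\<^sup>2)"
    proof -
      have "inner (H *v d) (z - x) \<le> norm (H *v d) * norm (z - x)" by (rule norm_cauchy_schwarz)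
      also have "\<dots> \<le> ((M + \<mu>) * norm d) * norm (z - x)"
        using norm_H by (rule mult_right_mono) simp
      also have "\<dots> = (M + \<mu>) * (norm d * norm (x - z))" by (simp add: norm_minus_commute)
      also have "\<dots> \<le> (M + \<mu>) * ((norm d)\<^sup>2 + (norm (x - z))\<^sup>2)"
      proof (rule mult_left_mono)
        have "2 * (norm d * norm (x - z)) \<le> (norm d)\<^sup>2 + (norm (x - z))\<^sup>2"
          using sum_squares_bound[of "norm d" "norm (x - z)"] by (simp add: mult.assoc)
        moreover have "0 \<le> norm d * norm (x - z)" by simp
        ultimately show "norm d * norm (x - z) \<le> (norm d)\<^sup>2 + (norm (x - z))\<^sup>2" by linarith
      qed (use m \<mu> in simp)
      finally show ?thesis .
    qed
    moreover have "f (x + d) \<le> f x + inner (g x) d + L * (norm d)\<^sup>2"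
      using linearization_error[of "x + d" x] by (simp add: abs_le_iff)
    moreover have "f x + inner (g x) (z - x) - L * (norm (x - z))\<^sup>2 \<le> f z"
      using linearization_error[of z x] by (simp add: abs_le_iff norm_minus_commute)
    ultimately show ?thesis
      using dHd0 unfolding objective_def by (simp add: algebra_simps)
  qed
qed

lemma regularized_model_has_minimizer:
  assumes "m *\<^sub>R mat 1 \<preceq> B" "0 < m" "0 < \<mu>"
  shows "\<exists>d. is_global_min (reg_qmodel f \<phi> B \<mu> x) d"
proof -
  define H where "H = B + \<mu> *\<^sub>R mat 1"
  have Hv: "H *v v = B *v v + \<mu> *\<^sub>R v" for v
    unfolding H_def by (rule shifted_matrix_vector)
  have "reg_qmodel f \<phi> B \<mu> x = (\<lambda>d. f x + inner (g x) d + 1/2 * inner d (H *v d) + \<phi> (x + d))"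
    unfolding H_def by (rule reg_qmodel_eq_shifted_model)
  moreover have "(m + \<mu>) * (norm v)\<^sup>2 \<le> inner v (H *v v)" for v
    using loewner_le_scaled_identityD(1)[OF assms(1), of v]
    unfolding Hv by (simp add: inner_add_right power2_norm_eq_inner algebra_simps)
  ultimately show ?thesis
    using strongly_convex_model_has_minimizer[OF convex, of "m + \<mu>" H "f x" "g x" x] assms by simp
qed

text \<open>For large \<open>\<mu>\<close> both tests succeed. The ratio of the predicted reduction to
  \<open>norm d * norm (r x)\<close> is at least \<open>(m / 2 + \<mu>) / (1 + M + \<mu>)\<close>, which exceeds \<open>1 / 2 > p_min\<close> as soon
  as \<open>\<mu> \<ge> 1 + M\<close>; and the linearization error \<open>L * (norm d)\<^sup>2\<close> is less than half of the predicted
  reduction as soon as \<open>\<mu> \<ge> 2 * L\<close>, which keeps \<open>\<rho>\<close> above \<open>1 / 2 > c1\<close>. The threshold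
  \<open>1 + M + 2 * L\<close> serves both.\<close>

lemma reg_prox_qn_step_consequences:
  assumes step: "reg_prox_qn_step f \<phi> p_min c1 c2 \<sigma>1 \<sigma>2 B d x \<mu> x' \<mu>'"
    and sym: "transpose B = B" and m: "0 < m" "m \<le> M" and \<mu>: "0 < \<mu>"
    and B: "m *\<^sub>R mat 1 \<preceq> B" "B \<preceq> M *\<^sub>R mat 1"
    and x: "x \<notin> X"
    and p_min: "0 < p_min" "p_min < 1/2"
    and c1: "c1 < 1/2"
    and sigma1: "0 < \<sigma>1" "\<sigma>1 < 1"
    and sigma2: "\<sigma>2 > 1"
  shows accepted_step: "x' \<noteq> x \<Longrightarrow> x' = x + d \<and> c1 * pred_red f \<phi> B x d < ared_red f \<phi> x d"
    and step_minimizer: "is_global_min (reg_qmodel f \<phi> B \<mu> x) d"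
    and parameter_pos: "0 < \<mu>'" and parameter_growth: "\<mu>' \<le> \<sigma>2 * \<mu>"
    and parameter_nonincreasing: "1 + M + 2 * L \<le> \<mu> \<Longrightarrow> \<mu>' \<le> \<mu>"
proof -
  let ?p = "pred_red f \<phi> B x d" and ?a = "ared_red f \<phi> x d"
  have ex: "\<exists>e. is_global_min (reg_qmodel f \<phi> B \<mu> x) e"
    by (rule regularized_model_has_minimizer[OF B(1) m(1) \<mu>])
  then show min: "is_global_min (reg_qmodel f \<phi> B \<mu> x) d"
    using step unfolding reg_prox_qn_step_def by blast
  note subproblem = sym m \<mu> B min
  have "0 < norm (r x)" using residual_nonzero[OF x] by simp
  with step_residual[OF subproblem] have "d \<noteq> 0" by auto
  then have d: "0 < norm d" "0 < (norm d)\<^sup>2" by auto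
  have "0 < (m / 2 + \<mu>) * (norm d)\<^sup>2" using m \<mu> d by (intro mult_pos_pos) auto
  then have p: "0 < ?p" using step_pred[OF subproblem] by linarith
  define bad where "bad \<longleftrightarrow> ?p \<le> p_min * norm d * norm (r x)"
  define \<rho> where "\<rho> = ?a / ?p"
  have st: "if bad then x' = x \<and> \<mu>' = \<sigma>2 * \<mu>
      else x' = (if \<rho> \<le> c1 then x else x + d) \<and>
           \<mu>' = (if \<rho> \<le> c1 then \<sigma>2 * \<mu> else if \<rho> \<le> c2 then \<mu> else \<sigma>1 * \<mu>)"
    using step ex unfolding reg_prox_qn_step_def bad_def \<rho>_def Let_def by simp
  show "x' = x + d \<and> c1 * ?p < ?a" if "x' \<noteq> x"
    using st that p unfolding \<rho>_def by (auto split: if_splits simp: field_simps)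
  have less: "\<sigma>1 * \<mu> \<le> \<mu>" "\<mu> \<le> \<sigma>2 * \<mu>" "0 < \<sigma>1 * \<mu>" using \<mu> sigma1 sigma2 by auto
  show "0 < \<mu>'" "\<mu>' \<le> \<sigma>2 * \<mu>"
    using st less \<mu> by (auto split: if_splits)
  show "\<mu>' \<le> \<mu>" if big: "1 + M + 2 * L \<le> \<mu>"
  proof -
    have "p_min * norm d * norm (r x) \<le> p_min * norm d * ((1 + M + \<mu>) * norm d)"
      using step_residual[OF subproblem] p_min d by (intro mult_left_mono) auto
    also have "\<dots> = (p_min * (1 + M + \<mu>)) * (norm d)\<^sup>2" by (simp add: power2_eq_square)
    also have "\<dots> < (m / 2 + \<mu>) * (norm d)\<^sup>2"
    proof (rule mult_strict_right_mono)
      have "p_min * (1 + M + \<mu>) \<le> 1/2 * (1 + M + \<mu>)"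
        using p_min m \<mu> by (intro mult_right_mono) auto
      also have "\<dots> < m / 2 + \<mu>" using big L_nonneg m by simp
      finally show "p_min * (1 + M + \<mu>) < m / 2 + \<mu>" .
    qed (rule d)
    also have "\<dots> \<le> ?p" by (rule step_pred[OF subproblem])
    finally have "\<not> bad" unfolding bad_def by simp
    moreover have "c1 < \<rho>"
    proof -
      have "L * (norm d)\<^sup>2 < 1/2 * (m / 2 + \<mu>) * (norm d)\<^sup>2"
        using d big m by (intro mult_strict_right_mono) auto
      also have "\<dots> \<le> 1/2 * ?p" using step_pred[OF subproblem] by simp
      finally have "1/2 * ?p < ?a" using step_ared[OF subproblem] by linarith
      moreover have "c1 * ?p < 1/2 * ?p" using c1 p by (intro mult_strict_right_mono) auto
      ultimately have "c1 * ?p < ?a" by linarith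
      then show ?thesis using p unfolding \<rho>_def by (simp add: pos_less_divide_eq)
    qed
    ultimately show ?thesis using st less by (auto split: if_splits)
  qed
qed

end

section \<open>Convergence of the method\<close>

theorem theorem5p5:
  fixes f \<phi> :: "real ^ 'n \<Rightarrow> real"
    and x d :: "nat \<Rightarrow> real ^ 'n"
    and B :: "nat \<Rightarrow> real ^ 'n ^ 'n"
    and \<mu> :: "nat \<Rightarrow> real"
    and p_min c1 c2 \<sigma>1 \<sigma>2 m M :: real
  assumes f_diff: "\<And>y. f differentiable (at y)"
    and f_C1: "continuous_on UNIV (gradient f)"
    and f_lip: "\<exists>L. L-lipschitz_on UNIV (gradient f)"
    and phi_convex: "convex_on UNIV \<phi>"
    and mu0: "\<mu> 0 > 0"
    and p_min: "0 < p_min" "p_min < 1/2"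
    and c1: "0 < c1" "c1 < 1/2"
    and c2: "c1 < c2" "c2 < 1"
    and sigma1: "0 < \<sigma>1" "\<sigma>1 < 1"
    and sigma2: "\<sigma>2 > 1"
    and generated: "reg_prox_qn_sequence f \<phi> p_min c1 c2 \<sigma>1 \<sigma>2 B d x \<mu>"
    and not_stationary: "\<And>k. x k \<notin> stationary_points f \<phi>"
    and B_sym: "\<And>k. transpose (B k) = B k"
    and mM: "0 < m" "m \<le> M"
    and B_bounds: "\<And>k. m *\<^sub>R mat 1 \<preceq> B k" "\<And>k. B k \<preceq> M *\<^sub>R mat 1"
    and psi_bdd: "bdd_below (range (objective f \<phi>))"
    and stationary_nonempty: "stationary_points f \<phi> \<noteq> {}"
    and error_bound: "\<And>\<zeta>. \<zeta> \<ge> (INF y. objective f \<phi> y) \<Longrightarrow>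
      \<exists>\<tau>>0. \<exists>\<epsilon>>0. \<forall>y. objective f \<phi> y \<le> \<zeta> \<and> norm (residual f \<phi> y) \<le> \<epsilon> \<longrightarrow>
        infdist y (stationary_points f \<phi>) \<le> \<tau> * norm (residual f \<phi> y)"
    and separation: "\<exists>\<delta>>0. \<forall>y \<in> stationary_points f \<phi>. \<forall>z \<in> stationary_points f \<phi>.
      objective f \<phi> y \<noteq> objective f \<phi> z \<longrightarrow> norm (y - z) \<ge> \<delta>"
  shows "(\<exists>xbar. x \<longlonglongrightarrow> xbar) \<and> summable (\<lambda>k. norm (x (Suc k) - x k))"
proof -
  from f_lip obtain L where L: "L-lipschitz_on UNIV (gradient f)" by blast
  interpret composite_problem f \<phi> L
    using f_diff L phi_convex by unfold_locales
  have step: "reg_prox_qn_step f \<phi> p_min c1 c2 \<sigma>1 \<sigma>2 (B k) (d k) (x k) (\<mu> k) (x (Suc k)) (\<mu> (Suc k))"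
    for k using generated unfolding reg_prox_qn_sequence_def by blast
  note setting = B_sym mM _ B_bounds not_stationary p_min c1(2) sigma1 sigma2
  have mu_pos: "0 < \<mu> k" for k
    by (induction k) (use mu0 parameter_pos[OF step setting] in auto)
  \<comment> \<open>The parameter increases only from below the threshold \<open>1 + M + 2 * L\<close>, and then by the
    factor \<open>\<sigma>2\<close>.\<close>
  define \<mu>' where "\<mu>' = max (\<mu> 0) (\<sigma>2 * (1 + M + 2 * L))"
  have mu_le: "\<mu> k \<le> \<mu>'" for k
  proof (induction k)
    case (Suc k)
    show ?case
    proof (cases "1 + M + 2 * L \<le> \<mu> k")
      case True then show ?thesis using parameter_nonincreasing[OF step setting, OF mu_pos True] Suc by simp
    next
      case False
      then have "\<sigma>2 * \<mu> k \<le> \<sigma>2 * (1 + M + 2 * L)" using sigma2 by simp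
      then show ?thesis using parameter_growth[OF step setting, OF mu_pos, of k] unfolding \<mu>'_def by linarith
    qed
  qed (simp add: \<mu>'_def)
  define s where "s k = norm (x (Suc k) - x k)" for k
  define K where "K = 1 + M + \<mu>' + L"
  have mu'_pos: "0 < \<mu>'" using mu_pos[of 0] mu_le[of 0] by linarith
  have K: "0 < K" using mu'_pos mM L_nonneg unfolding K_def by linarith
  have moved: "x (Suc k) = x k + d k" "s k = norm (d k)"
      "c1 * pred_red f \<phi> (B k) (x k) (d k) < ared_red f \<phi> (x k) (d k)" if "s k \<noteq> 0" for k
    using accepted_step[OF step setting, OF mu_pos, of k] that unfolding s_def by auto
  note subproblem = B_sym mM mu_pos B_bounds step_minimizer[OF step setting, OF mu_pos]
  obtain \<tau> \<epsilon> where \<tau>: "0 < \<tau>" "0 < \<epsilon>"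
    and eb: "\<And>y. \<psi> y \<le> \<psi> (x 0) \<Longrightarrow> norm (r y) \<le> \<epsilon> \<Longrightarrow> infdist y X \<le> \<tau> * norm (r y)"
    using error_bound[OF cINF_lower[OF psi_bdd UNIV_I, of "x 0"]] by blast
  obtain \<delta> where \<delta>: "0 < \<delta>"
    and sep: "\<And>y z. y \<in> X \<Longrightarrow> z \<in> X \<Longrightarrow> \<psi> y \<noteq> \<psi> z \<Longrightarrow> \<delta> \<le> norm (y - z)"
    using separation by blast
  have summable: "summable (\<lambda>k. norm (x (Suc k) - x k))"
  proof (rule summable_descent_under_error_bound[OF _ K _ _ _ not_stationary
        stationary_nonempty psi_bdd \<tau> eb \<delta> sep], fold s_def)
    show "0 < c1 * (m / 2)" using c1 mM by simp
    fix k assume sk: "s k \<noteq> 0"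
    have "m / 2 * (norm (d k))\<^sup>2 \<le> (m / 2 + \<mu> k) * (norm (d k))\<^sup>2"
      using mu_pos[of k] by (intro mult_right_mono) auto
    then have "c1 * (m / 2 * (norm (d k))\<^sup>2) \<le> c1 * pred_red f \<phi> (B k) (x k) (d k)"
      using c1 step_pred[OF subproblem, of k] by (intro mult_left_mono) linarith+
    then show "c1 * (m / 2) * (s k)\<^sup>2 \<le> \<psi> (x k) - \<psi> (x (Suc k))"
      using moved[OF sk] unfolding ared_red_def by (simp add: mult.assoc)
    show "norm (r (x k)) \<le> K * s k"
      using step_residual[OF subproblem, of k] mult_right_mono[of "1 + M + \<mu> k" K "norm (d k)"] mu_le[of k] L_nonneg
      unfolding moved(2)[OF sk] K_def by simp
    show "\<psi> (x (Suc k)) - \<psi> z \<le> K * ((s k)\<^sup>2 + (norm (x k - z))\<^sup>2)" if "z \<in> X" for z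
      using step_near[OF subproblem that, of k] mu_le[of k]
        mult_right_mono[of "M + \<mu> k + L" K "(norm (d k))\<^sup>2 + (norm (x k - z))\<^sup>2"]
      unfolding moved[OF sk] K_def by simp
  qed
  have "convergent (\<lambda>n. \<Sum>k<n. x (Suc k) - x k)"
    using summable_norm_cancel[OF summable] by (simp add: summable_iff_convergent)
  then have "convergent (\<lambda>n. x n - x 0)" by (simp add: sum_lessThan_telescope)
  then have "convergent (\<lambda>n. (x n - x 0) + x 0)" by (intro convergent_add convergent_const)
  then show ?thesis using summable unfolding convergent_def by simp
qed

end
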